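(* Let $n \geq 1$ be an integer, let $M$ be a perfect matching of the complete bipartite graph $K_{n,n}$, and let $H = K_{n,n} - M$ be the graph obtained from $K_{n,n}$ by deleting the edges of $M$. Then the Bell number of $H$ is \[ B(H) = \sum_{k=0}^{n} \binom{n}{k} B_k^2 . \]
   Context: For a finite simple graph $G=(V,E)$, a proper partition of $G$ is a partition of $V$ into non-empty, pairwise disjoint subsets (parts), each of which is an independent set of $G$ (no two vertices in the same part are adjacent). The Bell number $B(G)$ of $G$ is the total number of proper partitions of $G$. $B_k$ denotes the classical $k$-th Bell number, i.e. the number of partitions of a $k$-element set into non-empty subsets, with $B_0 = 1$. Deleting $M$ removes only edges, so $H$ has the same $2n$ vertices as $K_{n,n}$. *)

theory Defs
  imports "Graph_Theory.Kuratowski" "HOL-Library.Disjoint_Sets"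
begin

text \<open>
  As in \<^theory>\<open>Graph_Theory.Digraph\<close>, a finite simple graph is a finite symmetric digraph without
  loops and parallel arcs (locale \<^locale>\<open>graph\<close>): an edge $uv$ is the pair of arcs
  $u \to v$ and $v \to u$.
\<close>

definition independent_set :: "('a,'b) pre_digraph \<Rightarrow> 'a set \<Rightarrow> bool" where
  "independent_set G S \<longleftrightarrow> S \<subseteq> verts G \<and> (\<forall>u\<in>S. \<forall>v\<in>S. \<not> u \<rightarrow>\<^bsub>G\<^esub> v)"

definition proper_partition :: "('a,'b) pre_digraph \<Rightarrow> 'a set set \<Rightarrow> bool" where
  "proper_partition G P \<longleftrightarrow> partition_on (verts G) P \<and> (\<forall>S\<in>P. independent_set G S)"

definition graph_Bell :: "('a,'b) pre_digraph \<Rightarrow> nat" where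
  "graph_Bell G = card {P. proper_partition G P}"

definition Bell :: "nat \<Rightarrow> nat" where
  "Bell k = card {P. partition_on {..<k} P}"

text \<open>
  A set of undirected edges is a set of arcs closed under reversal, which is what symmetry of the
  subgraph with arc set \<open>M\<close> says. The arcs of such a set with tail \<open>v\<close> then correspond one-to-one
  to the edges incident with \<open>v\<close>, so the last conjunct says that every vertex lies on exactly one
  edge of \<open>M\<close>.
\<close>

definition perfect_matching :: "('a,'b) pre_digraph \<Rightarrow> 'b set \<Rightarrow> bool" where
  "perfect_matching G M \<longleftrightarrow>
     M \<subseteq> arcs G \<and> symmetric (G\<lparr>arcs := M\<rparr>) \<and> (\<forall>v\<in>verts G. \<exists>!e. e \<in> M \<and> tail G e = v)"

definition delete_edges :: "('a,'b) pre_digraph \<Rightarrow> 'b set \<Rightarrow> ('a,'b) pre_digraph" where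
  "delete_edges G M = G\<lparr>arcs := arcs G - M\<rparr>"

lemma Bell_0: "Bell 0 = 1"
proof -
  have "{P. partition_on {..<0::nat} P} = {{}}"
    by (auto simp: partition_on_def)
  then show ?thesis by (simp add: Bell_def)
qed

lemma (in graph) graph_delete_perfect_matching:
  assumes "perfect_matching G M"
  shows "graph (delete_edges G M)"
proof -
  let ?H = "delete_edges G M"
  have M: "M \<subseteq> arcs G" "symmetric (G\<lparr>arcs := M\<rparr>)"
    using assms by (auto simp: perfect_matching_def)
  have "symmetric ?H"
    unfolding symmetric_conv
  proof
    fix e assume e: "e \<in> arcs ?H"
    then have eG: "e \<in> arcs G" "e \<notin> M" by (auto simp: delete_edges_def)
    obtain f where f: "f \<in> arcs G" "tail G e = head G f" "head G e = tail G f"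
      using sym_arcs eG(1) by (auto simp: symmetric_conv)
    have "f \<notin> M"
    proof
      assume "f \<in> M"
      then obtain g where g: "g \<in> M" "tail G f = head G g" "head G f = tail G g"
        using M(2) by (auto simp: symmetric_conv)
      then have "g = e"
        using f eG M(1) by (intro no_multi_arcs) (auto simp: arc_to_ends_def)
      then show False using g(1) eG(2) by simp
    qed
    then show "\<exists>f\<in>arcs ?H. tail ?H e = head ?H f \<and> head ?H e = tail ?H f"
      using f by (auto simp: delete_edges_def)
  qed
  then show ?thesis
    using no_loops no_multi_arcs
    by unfold_locales (auto simp: delete_edges_def arc_to_ends_def)
qed

end

theory Submission
  imports Defs
begin

text \<open>
  The graph \<open>H\<close> has a simple description: there are sides \<open>U\<close>, \<open>V\<close> of size \<open>n\<close> and a bijection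
  \<open>f\<close> from \<open>U\<close> to \<open>V\<close> (the matching) such that \<open>u \<in> U\<close> and \<open>v \<in> V\<close> are adjacent exactly when
  \<open>v \<noteq> f u\<close>. An independent set that meets both sides therefore contains, with any \<open>u \<in> U\<close>, no
  vertex of \<open>V\<close> but \<open>f u\<close>, and by injectivity of \<open>f\<close> no other vertex of \<open>U\<close>: it is a matched pair
  \<open>{u, f u}\<close>.

  So a proper partition of \<open>H\<close> consists of some matched pairs together with a partition of what is
  left of \<open>U\<close> and a partition of what is left of \<open>V\<close>, and these three choices are independent of
  each other once the set \<open>B \<subseteq> U\<close> of vertices outside the chosen pairs is fixed. What is left is
  \<open>B\<close> on one side and \<open>f ` B\<close> on the other, so \<open>B\<close> contributes \<open>(Bell (card B))\<^sup>2\<close> partitions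
  (lemma \<open>bij_betw_proper_partitions\<close>). Grouping the sets \<open>B\<close> by their size \<open>k\<close> produces the
  binomial coefficients.
\<close>

section \<open>Counting partitions and subsets\<close>

text \<open>
  For a bijection \<open>g\<close>, taking images of all parts is a bijection between partitions whose inverse
  is given by the inverse of \<open>g\<close>.
\<close>

lemma card_partitions_bij_betw:
  assumes "bij_betw g A B"
  shows "card {P. partition_on A P} = card {P. partition_on B P}"
proof (rule bij_betw_same_card)
  have image_part: "partition_on D ((`) h ` P)"
    if h: "bij_betw h C D" and P: "partition_on C P" for h :: "'c \<Rightarrow> 'd" and C D P
  proof -
    have "{} \<notin> (`) h ` P" using partition_onD3[OF P] by auto
    then show ?thesis
      using partition_on_inj_image[OF P, of h] h by (simp add: bij_betw_def)
  qed
  have cancel: "(`) h' ` (`) h ` P = P"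
    if P: "partition_on C P" and inv: "\<And>x. x \<in> C \<Longrightarrow> h' (h x) = x"
    for h :: "'c \<Rightarrow> 'd" and h' C P
  proof -
    have "h' ` h ` p = p" if "p \<in> P" for p
    proof -
      have "h' (h x) = x" if "x \<in> p" for x
        using that \<open>p \<in> P\<close> inv partition_onD1[OF P] by blast
      then show ?thesis by (auto simp: image_iff)
    qed
    then show ?thesis by (auto simp: image_iff)
  qed
  let ?k = "inv_into A g"
  show "bij_betw ((`) ((`) g)) {P. partition_on A P} {P. partition_on B P}"
  proof (rule bij_betw_byWitness[where f' = "(`) ((`) ?k)"])
    show "\<forall>P\<in>{P. partition_on A P}. (`) ?k ` (`) g ` P = P"
      by (auto intro!: cancel simp: bij_betw_inv_into_left[OF assms])
    show "\<forall>P\<in>{P. partition_on B P}. (`) g ` (`) ?k ` P = P"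
      by (auto intro!: cancel simp: bij_betw_inv_into_right[OF assms])
  qed (use image_part[OF assms] image_part[OF bij_betw_inv_into[OF assms]] in auto)
qed

lemma card_partitions_eq_Bell:
  assumes "finite A"
  shows "card {P. partition_on A P} = Bell (card A)"
proof -
  obtain g where "bij_betw g A {0..<card A}"
    using ex_bij_betw_finite_nat[OF assms] by blast
  from card_partitions_bij_betw[OF this] show ?thesis
    by (simp add: Bell_def atLeast0LessThan)
qed

lemma sum_Pow_by_card:
  fixes F :: "nat \<Rightarrow> nat"
  assumes "finite A"
  shows "(\<Sum>B\<in>Pow A. F (card B)) = (\<Sum>k=0..card A. (card A choose k) * F k)"
proof -
  have "(\<Sum>B\<in>Pow A. F (card B))
      = (\<Sum>k\<in>{0..card A}. \<Sum>B\<in>{B \<in> Pow A. card B = k}. F (card B))"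
    using assms by (intro sum.group[symmetric]) (auto intro: card_mono)
  also have "\<dots> = (\<Sum>k=0..card A. (card A choose k) * F k)"
  proof (rule sum.cong[OF refl])
    fix k
    have "{B \<in> Pow A. card B = k} = {B. B \<subseteq> A \<and> card B = k}" by auto
    then show "(\<Sum>B\<in>{B \<in> Pow A. card B = k}. F (card B)) = (card A choose k) * F k"
      using n_subsets[OF assms, of k] by simp
  qed
  finally show ?thesis .
qed

section \<open>The complete bipartite graph minus a perfect matching\<close>

text \<open>
  The relation \<open>m\<close> of matched vertices is symmetric, functional and total on the vertices, and it
  only joins opposite sides. Hence its restriction to \<open>U\<close> is a function, and its restriction to
  \<open>V\<close> is the inverse of that function. Parallel arcs being excluded, deleting the arcs in \<open>M\<close>
  removes precisely the pairs in \<open>m\<close> from the adjacency relation.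
\<close>

lemma bipartite_minus_matching_structure:
  assumes K: "K\<^bsub>n,n\<^esub> K" and M: "perfect_matching K M"
  obtains U V f where
    "verts K = U \<union> V" "finite (verts K)" "U \<inter> V = {}" "card U = n" "bij_betw f U V"
    "arcs_ends (delete_edges K M)
       = {(u,v). u \<in> U \<and> v \<in> V \<and> v \<noteq> f u} \<union> {(v,u). u \<in> U \<and> v \<in> V \<and> v \<noteq> f u}"
proof -
  obtain U V where "graph K" and UV: "verts K = U \<union> V" "U \<inter> V = {}" "card U = n"
    and ends: "arcs_ends K = U \<times> V \<union> V \<times> U"
    using K unfolding complete_bipartite_digraph_def by blast
  interpret graph K by fact
  define m where "m = arc_to_ends K ` M"
  have MK: "M \<subseteq> arcs K" and uniq: "\<And>v. v \<in> verts K \<Longrightarrow> \<exists>!e. e \<in> M \<and> tail K e = v"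
    using M by (auto simp: perfect_matching_def)
  have m_sub: "m \<subseteq> U \<times> V \<union> V \<times> U"
    using MK ends by (auto simp: m_def arcs_ends_def)
  have "m = arcs_ends (K\<lparr>arcs := M\<rparr>)"
    by (simp add: m_def arcs_ends_def arc_to_ends_def)
  then have m_sym: "(y, x) \<in> m" if "(x, y) \<in> m" for x y
    using M that by (auto simp: perfect_matching_def symmetric_def dest: symD)
  have m_uniq: "\<exists>!w. (v, w) \<in> m" if "v \<in> U \<union> V" for v
  proof -
    from uniq[of v] that UV(1) obtain e where e: "e \<in> M" "tail K e = v"
      and eq: "\<And>e'. e' \<in> M \<Longrightarrow> tail K e' = v \<Longrightarrow> e' = e" by blast
    show ?thesis
    proof (rule ex1I[of _ "head K e"])
      show "(v, head K e) \<in> m" using e by (force simp: m_def arc_to_ends_def)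
      show "w = head K e" if "(v, w) \<in> m" for w
        using that eq by (auto simp: m_def arc_to_ends_def)
    qed
  qed
  define f where "f v = (THE w. (v, w) \<in> m)" for v
  have f: "(v, w) \<in> m \<longleftrightarrow> w = f v" if "v \<in> U \<union> V" for v w
    using theI'[OF m_uniq[OF that]] m_uniq[OF that] unfolding f_def by blast
  have f_UV: "f u \<in> V" if "u \<in> U" for u
    using f[of u "f u"] m_sub that UV(2) by auto
  have f_VU: "f v \<in> U" if "v \<in> V" for v
    using f[of v "f v"] m_sub that UV(2) by auto
  have ff: "f (f v) = v" if "v \<in> U \<union> V" for v
    using f[of v "f v"] f[of "f v" v] f_UV f_VU m_sym that by (metis Un_iff)
  have "bij_betw f U V"
    by (rule bij_betw_byWitness[where f' = f]) (use f_UV f_VU ff in auto)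
  moreover have "arcs_ends (delete_edges K M) = arcs_ends K - m"
    using MK inj_on_image_set_diff[OF inj_on_arc_to_ends, of "arcs K" M]
    by (simp add: delete_edges_def arcs_ends_def m_def arc_to_ends_def)
  then have "arcs_ends (delete_edges K M)
       = {(u,v). u \<in> U \<and> v \<in> V \<and> v \<noteq> f u} \<union> {(v,u). u \<in> U \<and> v \<in> V \<and> v \<noteq> f u}"
    using f m_sym unfolding ends by blast
  ultimately show thesis using that UV finite_verts by blast
qed

section \<open>Proper partitions\<close>

text \<open>
  A proper partition is rebuilt from the set \<open>B\<close> of vertices of \<open>U\<close> outside its matched pairs, its
  parts \<open>P\<close> inside \<open>U\<close> and its parts \<open>Q\<close> inside \<open>V\<close>. The data are recovered from the partition by
  looking at which pairs occur and which parts lie inside a single side, since a matched pair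
  meets both sides and no part is empty.
\<close>

lemma bij_betw_proper_partitions:
  fixes f :: "'a \<Rightarrow> 'a" and H :: "('a,'b) pre_digraph"
  assumes verts: "verts H = U \<union> V" and disj: "U \<inter> V = {}" and f: "bij_betw f U V"
    and ends: "arcs_ends H
       = {(u,v). u \<in> U \<and> v \<in> V \<and> v \<noteq> f u} \<union> {(v,u). u \<in> U \<and> v \<in> V \<and> v \<noteq> f u}"
  shows "bij_betw (\<lambda>(B, P, Q). (\<lambda>u. {u, f u}) ` (U - B) \<union> P \<union> Q)
    (SIGMA B:Pow U. {P. partition_on B P} \<times> {Q. partition_on (f ` B) Q})
    {R. proper_partition H R}"
proof -
  have fV: "f u \<in> V" if "u \<in> U" for u
    using that f by (auto simp: bij_betw_def)
  have f_eq: "u = u'" if "f u = f u'" "u \<in> U" "u' \<in> U" for u u'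
    using that f by (auto simp: bij_betw_def inj_on_def)
  have fU: "f ` U = V" using f by (simp add: bij_betw_def)
  have indep: "independent_set H S \<longleftrightarrow> S \<subseteq> U \<or> S \<subseteq> V \<or> (\<exists>u\<in>U. S = {u, f u})" for S
  proof
    assume "independent_set H S"
    then have S: "S \<subseteq> U \<union> V" and matched: "\<And>u v. u \<in> S \<Longrightarrow> v \<in> S \<Longrightarrow> u \<in> U \<Longrightarrow> v \<in> V \<Longrightarrow> v = f u"
      by (auto simp: independent_set_def verts ends)
    show "S \<subseteq> U \<or> S \<subseteq> V \<or> (\<exists>u\<in>U. S = {u, f u})"
    proof (rule ccontr)
      assume no: "\<not> ?thesis"
      then obtain u v where uv: "u \<in> S" "u \<in> U" "v \<in> S" "v \<in> V" using S by blast
      have "S = {u, f u}"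
      proof
        show "S \<subseteq> {u, f u}"
        proof
          fix x assume x: "x \<in> S"
          then consider "x \<in> U" | "x \<in> V" using S by blast
          then show "x \<in> {u, f u}"
          proof cases
            case 1
            then have "f x = f u" using matched[OF x uv(3)] matched[OF uv(1,3)] uv by simp
            then show ?thesis using f_eq 1 uv(2) by simp
          next
            case 2
            then show ?thesis using matched[OF uv(1) x uv(2)] by simp
          qed
        qed
        show "{u, f u} \<subseteq> S" using uv matched by auto
      qed
      then show False using no uv by blast
    qed
  next
    show "independent_set H S" if "S \<subseteq> U \<or> S \<subseteq> V \<or> (\<exists>u\<in>U. S = {u, f u})"
      using that disj fV unfolding independent_set_def verts ends by auto
  qed
  define rebuild where "rebuild = (\<lambda>(B, P, Q). (\<lambda>u. {u, f u}) ` (U - B) \<union> P \<union> Q)"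
  define split where "split R = ({u\<in>U. {u, f u} \<notin> R}, {S\<in>R. S \<subseteq> U}, {S\<in>R. S \<subseteq> V})" for R
  let ?D = "SIGMA B:Pow U. {P. partition_on B P} \<times> {Q. partition_on (f ` B) Q}"

  have split_rebuild: "split (rebuild (B, P, Q)) = (B, P, Q)"
    and proper_rebuild: "proper_partition H (rebuild (B, P, Q))"
    if B: "B \<subseteq> U" and P: "partition_on B P" and Q: "partition_on (f ` B) Q" for B P Q
  proof -
    have PU: "S \<noteq> {} \<and> S \<subseteq> B" if "S \<in> P" for S
      using P that by (auto simp: partition_on_def)
    have QV: "S \<noteq> {} \<and> S \<subseteq> f ` B" if "S \<in> Q" for S
      using Q that by (auto simp: partition_on_def)
    have fB: "f ` B \<subseteq> V" using B fV by auto
    have mixed: "\<not> {u, f u} \<subseteq> U" "\<not> {u, f u} \<subseteq> V" if "u \<in> U" for u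
      using that fV disj by auto
    have pair_eq: "u = u'" if "{u, f u} = {u', f u'}" "u \<in> U" "u' \<in> U" for u u'
      using that fV disj by (metis disjoint_iff doubleton_eq_iff)
    have "{u\<in>U. {u, f u} \<notin> rebuild (B, P, Q)} = B"
    proof -
      have "{u, f u} \<notin> P" "{u, f u} \<notin> Q" if "u \<in> U" for u
        using mixed[OF that] PU QV B fB by (meson subset_trans)+
      moreover have "{u, f u} \<in> (\<lambda>u. {u, f u}) ` (U - B) \<longleftrightarrow> u \<notin> B" if "u \<in> U" for u
        using pair_eq[of u] that by blast
      ultimately show ?thesis using B unfolding rebuild_def by auto
    qed
    moreover have "{S \<in> rebuild (B, P, Q). S \<subseteq> U} = P"
    proof -
      have "\<not> S \<subseteq> U" if "S \<in> Q" for S using QV[OF that] fB disj by blast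
      moreover have "S \<subseteq> U" if "S \<in> P" for S using PU[OF that] B by blast
      ultimately show ?thesis using mixed(1) unfolding rebuild_def by auto
    qed
    moreover have "{S \<in> rebuild (B, P, Q). S \<subseteq> V} = Q"
    proof -
      have "\<not> S \<subseteq> V" if "S \<in> P" for S using PU[OF that] B disj by blast
      moreover have "S \<subseteq> V" if "S \<in> Q" for S using QV[OF that] fB by blast
      ultimately show ?thesis using mixed(2) unfolding rebuild_def by auto
    qed
    ultimately show "split (rebuild (B, P, Q)) = (B, P, Q)"
      by (simp add: split_def)

    have "partition_on (U \<union> V) (rebuild (B, P, Q))"
    proof (rule partition_onI)
      have "\<Union>P = B" "\<Union>Q = f ` B" using P Q by (auto simp: partition_on_def)
      then show "\<Union>(rebuild (B, P, Q)) = U \<union> V"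
        using B fU by (auto simp: rebuild_def)
      show "{} \<notin> rebuild (B, P, Q)"
        using PU QV by (auto simp: rebuild_def)
      fix S T assume ST: "S \<in> rebuild (B, P, Q)" "T \<in> rebuild (B, P, Q)" "S \<noteq> T"
      have pp: "disjnt {u, f u} {u', f u'}" if "u \<in> U" "u' \<in> U" "u \<noteq> u'" for u u'
        using that fV disj f_eq by (auto simp: disjnt_def)
      have pP: "disjnt {u, f u} X" if "u \<in> U - B" "X \<in> P" for u X
        using that PU[OF that(2)] fV[of u] B disj by (auto simp: disjnt_def)
      have pQ: "disjnt {u, f u} X" if "u \<in> U - B" "X \<in> Q" for u X
      proof -
        have "u \<notin> X" using that QV[OF that(2)] fB disj by blast
        moreover have "f u \<notin> f ` B" using that f_eq B by blast
        ultimately show ?thesis using QV[OF that(2)] by (auto simp: disjnt_def)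
      qed
      have PQ: "disjnt X Y" if "X \<in> P" "Y \<in> Q" for X Y
        using PU[OF that(1)] QV[OF that(2)] B fB disj unfolding disjnt_def by blast
      have PP: "disjnt X Y" if "X \<in> P" "Y \<in> P" "X \<noteq> Y" for X Y
        using partition_onD2[OF P] that by (auto simp: pairwise_def)
      have QQ: "disjnt X Y" if "X \<in> Q" "Y \<in> Q" "X \<noteq> Y" for X Y
        using partition_onD2[OF Q] that by (auto simp: pairwise_def)
      show "disjnt S T"
        using ST unfolding rebuild_def prod.case
        by (elim UnE imageE)
          (blast intro: pp pP pQ PQ PP QQ pP[THEN disjnt_sym] pQ[THEN disjnt_sym] PQ[THEN disjnt_sym])+
    qed
    moreover have "independent_set H S" if "S \<in> rebuild (B, P, Q)" for S
      using that PU QV B fB unfolding indep rebuild_def by blast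
    ultimately show "proper_partition H (rebuild (B, P, Q))"
      by (simp add: proper_partition_def verts)
  qed

  have rebuild_split: "rebuild (split R) = R" and split_in: "split R \<in> ?D"
    if R: "proper_partition H R" for R
  proof -
    have part: "partition_on (U \<union> V) R"
      and parts: "\<And>S. S \<in> R \<Longrightarrow> S \<subseteq> U \<or> S \<subseteq> V \<or> (\<exists>u\<in>U. S = {u, f u})"
      using R by (auto simp: proper_partition_def verts indep)
    have same: "S = T" if "x \<in> S" "x \<in> T" "S \<in> R" "T \<in> R" for x S T
      using partition_onD2[OF part] that by (auto simp: disjoint_def)
    have covered: "\<exists>S\<in>R. x \<in> S" if "x \<in> U \<union> V" for x
      using partition_onD1[OF part] that by auto
    have sub: "partition_on (\<Union>R') R'" if "R' \<subseteq> R" for R'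
      using part that unfolding partition_on_def by (blast intro: pairwise_subset)
    show "rebuild (split R) = R"
      using parts unfolding rebuild_def split_def by auto
    define B where "B = {u\<in>U. {u, f u} \<notin> R}"
    \<comment> \<open>A vertex lies in a single part, so the vertices outside the matched pairs are those
      whose part stays on one side.\<close>
    have "\<Union>{S\<in>R. S \<subseteq> U} = B"
    proof (intro equalityI subsetI)
      fix u assume "u \<in> \<Union>{S\<in>R. S \<subseteq> U}"
      then obtain S where S: "u \<in> S" "S \<in> R" "S \<subseteq> U" by blast
      have "{u, f u} \<notin> R"
        using same[of u S "{u, f u}"] S fV[of u] disj by auto
      then show "u \<in> B" using S by (auto simp: B_def)
    next
      fix u assume u: "u \<in> B"
      then obtain S where S: "S \<in> R" "u \<in> S" using covered by (auto simp: B_def)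
      then show "u \<in> \<Union>{S\<in>R. S \<subseteq> U}"
        using parts[OF S(1)] u fV disj by (auto simp: B_def)
    qed
    moreover have "\<Union>{S\<in>R. S \<subseteq> V} = f ` B"
    proof (intro equalityI subsetI)
      fix v assume "v \<in> \<Union>{S\<in>R. S \<subseteq> V}"
      then obtain S where S: "v \<in> S" "S \<in> R" "S \<subseteq> V" by blast
      then obtain u where u: "u \<in> U" "v = f u" using fU by blast
      have "{u, f u} \<notin> R"
        using same[of v S "{u, f u}"] S u disj by auto
      then show "v \<in> f ` B" using u by (auto simp: B_def)
    next
      fix v assume "v \<in> f ` B"
      then obtain u where u: "u \<in> U" "{u, f u} \<notin> R" "v = f u" by (auto simp: B_def)
      then obtain S where S: "S \<in> R" "v \<in> S" using covered fV by blast
      then have "S \<subseteq> V"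
        using parts[OF S(1)] u fV[OF u(1)] disj f_eq by fastforce
      then show "v \<in> \<Union>{S\<in>R. S \<subseteq> V}" using S by blast
    qed
    ultimately show "split R \<in> ?D"
      using sub[of "{S\<in>R. S \<subseteq> U}"] sub[of "{S\<in>R. S \<subseteq> V}"]
      by (auto simp: split_def B_def)
  qed
  have "bij_betw rebuild ?D {R. proper_partition H R}"
  proof (rule bij_betw_byWitness[where f' = split])
    show "\<forall>x\<in>?D. split (rebuild x) = x" using split_rebuild by auto
    show "rebuild ` ?D \<subseteq> {R. proper_partition H R}" using proper_rebuild by auto
    show "\<forall>R\<in>{R. proper_partition H R}. rebuild (split R) = R" using rebuild_split by blast
    show "split ` {R. proper_partition H R} \<subseteq> ?D" using split_in by blast
  qed
  then show ?thesis by (simp add: rebuild_def)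
qed

theorem corollary4:
  fixes n :: nat and K :: "('a,'b) pre_digraph" and M :: "'b set"
  assumes "n \<ge> 1"
    and "K\<^bsub>n,n\<^esub> K"
    and "perfect_matching K M"
  shows "graph_Bell (delete_edges K M) = (\<Sum>k=0..n. (n choose k) * (Bell k)\<^sup>2)"
proof -
  let ?H = "delete_edges K M"
  obtain U V f where verts: "verts K = U \<union> V" "finite (verts K)" and disj: "U \<inter> V = {}"
    and U: "card U = n" and f: "bij_betw f U V"
    and ends: "arcs_ends ?H
       = {(u,v). u \<in> U \<and> v \<in> V \<and> v \<noteq> f u} \<union> {(v,u). u \<in> U \<and> v \<in> V \<and> v \<noteq> f u}"
    by (rule bipartite_minus_matching_structure[OF assms(2,3)])
  have "verts ?H = U \<union> V" using verts by (simp add: delete_edges_def)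
  from bij_betw_same_card[OF bij_betw_proper_partitions[OF this disj f ends]]
  have "graph_Bell ?H
      = card (SIGMA B:Pow U. {P. partition_on B P} \<times> {Q. partition_on (f ` B) Q})"
    by (simp add: graph_Bell_def)
  also have "\<dots> = (\<Sum>B\<in>Pow U. card ({P. partition_on B P} \<times> {Q. partition_on (f ` B) Q}))"
  proof (rule card_SigmaI)
    show "finite (Pow U)" using verts by auto
    show "\<forall>B\<in>Pow U. finite ({P. partition_on B P} \<times> {Q. partition_on (f ` B) Q})"
      using verts by (auto intro!: finite_cartesian_product finitely_many_partition_on
          intro: finite_subset)
  qed
  also have "\<dots> = (\<Sum>B\<in>Pow U. (Bell (card B))\<^sup>2)"
  proof (rule sum.cong[OF refl])
    fix B assume "B \<in> Pow U"
    then have "finite B" "bij_betw f B (f ` B)"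
      using verts f by (auto intro: finite_subset inj_on_subset simp: bij_betw_def)
    then show "card ({P. partition_on B P} \<times> {Q. partition_on (f ` B) Q}) = (Bell (card B))\<^sup>2"
      using card_partitions_bij_betw[of f B "f ` B"] card_partitions_eq_Bell[of B]
      by (simp add: card_cartesian_product power2_eq_square)
  qed
  also have "\<dots> = (\<Sum>k=0..n. (n choose k) * (Bell k)\<^sup>2)"
    using sum_Pow_by_card[of U "\<lambda>k. (Bell k)\<^sup>2"] verts U by simp
  finally show ?thesis .
qed

end
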